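(* Let $m\ge2$. Let $D>0$ be a $C^\infty$ smooth function, $\nu=(\nu_J)$ a $C^\infty$ smooth unit vector field and $\vec F=(F_J)$ a $C^\infty$ smooth vector field, all defined locally (on an open set) in $\mathbb{R}^m$, satisfying for all $I,J$ $$ \delta_I\nu_J-\delta_J\nu_I=\frac1D\{h_{IJ}-\nu_J\nu_Kh_{IK}-\nu_I\nu_Kh_{KJ}\} $$ and $$ \nu^{\#}\lrcorner\, d(D\nu^{\#}-F^{\#})=0, $$ or, equivalently to the latter, $\delta_KD=\nu_J(\partial_J\nu_K)D-\nu_Jh_{JK}$ for all $K$. Then locally (in a neighborhood of each point) there exists a $C^\infty$ smooth function $u$ such that $$ \nu=\frac{\nabla u+\vec F}{D}. $$
   Context: Summation over repeated indices from $1$ to $m$ is understood. $\partial_K=\partial/\partial x^K$; $\delta_J := \partial_J-\nu_J\nu_K\partial_K$; $h_{IJ} := \partial_IF_J-\partial_JF_I$. The 1-forms $\nu^{\#} := \nu_Jdx^J$ and $F^{\#} := F_Jdx^J$. For a 1-form $\eta$ and 2-form $\omega$, $\eta\lrcorner\omega$ denotes the interior product of $\omega$ with the vector $\eta_{\#}$ corresponding to $\eta$ under the Euclidean metric, so that $dx^i\lrcorner(dx^j\wedge dx^k)=\delta^{ij}dx^k-\delta^{ik}dx^j$ (where $\delta^{ij}$ is the Kronecker delta). *)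

theory Defs
  imports "HOL-Analysis.Analysis"
begin

definition partial :: "'m::finite \<Rightarrow> (real^'m \<Rightarrow> real) \<Rightarrow> real^'m \<Rightarrow> real" where
  "partial J f x = deriv (\<lambda>t. f (x + t *\<^sub>R axis J 1)) 0"

definition grad :: "(real^'m::finite \<Rightarrow> real) \<Rightarrow> real^'m \<Rightarrow> real^'m" where
  "grad f x = (\<chi> J. partial J f x)"

text \<open>\<open>Ck_on k U f\<close> is meant for open \<open>U\<close>. Existence and continuity of the first-order partial
  derivatives on an open set imply differentiability, so requiring \<open>f\<close> to be (totally)
  differentiable in the recursive clause gives the usual class of functions whose partial
  derivatives up to order \<open>k\<close> exist and are continuous.\<close>

fun Ck_on :: "nat \<Rightarrow> (real^'m::finite) set \<Rightarrow> (real^'m \<Rightarrow> real) \<Rightarrow> bool" where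
  "Ck_on 0 U f \<longleftrightarrow> continuous_on U f"
| "Ck_on (Suc k) U f \<longleftrightarrow> f differentiable_on U \<and> (\<forall>J. Ck_on k U (partial J f))"

definition smooth_on :: "(real^'m::finite) set \<Rightarrow> (real^'m \<Rightarrow> real) \<Rightarrow> bool" where
  "smooth_on U f \<longleftrightarrow> (\<forall>k. Ck_on k U f)"

definition smooth_field_on :: "(real^'m::finite) set \<Rightarrow> (real^'m \<Rightarrow> real^'m) \<Rightarrow> bool" where
  "smooth_field_on U F \<longleftrightarrow> (\<forall>J. smooth_on U (\<lambda>x. F x $ J))"

definition delta :: "(real^'m::finite \<Rightarrow> real^'m) \<Rightarrow> 'm \<Rightarrow> (real^'m \<Rightarrow> real) \<Rightarrow> real^'m \<Rightarrow> real" where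
  "delta \<nu> J f x = partial J f x - \<nu> x $ J * (\<Sum>K\<in>UNIV. \<nu> x $ K * partial K f x)"

definition h :: "(real^'m::finite \<Rightarrow> real^'m) \<Rightarrow> 'm \<Rightarrow> 'm \<Rightarrow> real^'m \<Rightarrow> real" where
  "h F I J x = partial I (\<lambda>y. F y $ J) x - partial J (\<lambda>y. F y $ I) x"

text \<open>Covectors and alternating 2-tensors at a point are represented by the underlying (bi)linear
  functions on tangent vectors; a differential form is a function assigning to each point such
  an object.\<close>

type_synonym 'm covec = "real^'m \<Rightarrow> real"
type_synonym 'm covec2 = "real^'m \<Rightarrow> real^'m \<Rightarrow> real"

definition dx :: "'m::finite \<Rightarrow> 'm covec" where
  "dx J = (\<lambda>v. v $ J)"

definition wedge :: "'m::finite covec \<Rightarrow> 'm covec \<Rightarrow> 'm covec2" where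
  "wedge \<alpha> \<beta> = (\<lambda>v w. \<alpha> v * \<beta> w - \<alpha> w * \<beta> v)"

definition flat :: "(real^'m::finite \<Rightarrow> real^'m) \<Rightarrow> real^'m \<Rightarrow> 'm covec" where
  "flat F x = (\<lambda>v. \<Sum>J\<in>UNIV. F x $ J * dx J v)"

definition vec_of :: "'m::finite covec \<Rightarrow> real^'m" where
  "vec_of \<alpha> = (\<chi> J. \<alpha> (axis J 1))"

text \<open>The exterior derivative of \<open>\<eta> = \<eta>\<^sub>K dx\<^sup>K\<close>, where \<open>\<eta>\<^sub>K\<close> is the value of \<open>\<eta>\<close> on the \<open>K\<close>-th
  standard basis vector, is \<open>d\<eta>\<^sub>K \<and> dx\<^sup>K\<close>, expanded here in coordinates.\<close>

definition ext_d :: "(real^'m::finite \<Rightarrow> 'm covec) \<Rightarrow> real^'m \<Rightarrow> 'm covec2" where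
  "ext_d \<eta> x = (\<lambda>v w. \<Sum>K\<in>UNIV. \<Sum>J\<in>UNIV.
     partial J (\<lambda>y. \<eta> y (axis K 1)) x * wedge (dx J) (dx K) v w)"

definition interior_prod :: "'m::finite covec \<Rightarrow> 'm covec2 \<Rightarrow> 'm covec" where
  "interior_prod \<alpha> \<omega> = (\<lambda>w. \<omega> (vec_of \<alpha>) w)"

lemma interior_prod_dx_wedge:
  fixes i j k :: "'m::finite"
  shows "interior_prod (dx i) (wedge (dx j) (dx k)) =
    (\<lambda>v. (if i = j then 1 else 0) * dx k v - (if i = k then 1 else 0) * dx j v)"
  by (auto simp: interior_prod_def wedge_def dx_def vec_of_def axis_def)

end

theory Submission
  imports Defs
begin

text \<open>
  Put \<open>\<theta> = D\<nu> - F\<close>. Locally, a function \<open>u\<close> with \<open>\<nu> = (\<nabla>u + F) / D\<close> is the same thing as a potential of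
  \<open>\<theta>\<close>, so by the Poincare lemma on a ball everything reduces to showing that the 2-form
  \<open>d\<theta>\<^sup>#\<close>, whose coefficients are \<open>h \<theta> I J\<close>, vanishes.

  At each point \<open>d\<theta>\<^sup>#\<close> is determined by its contraction with the unit vector \<open>\<nu>\<close> and its
  restriction to \<open>\<nu>\<^sup>\<bottom>\<close>, and the two hypotheses kill these two pieces separately. The contraction is
  zero by the hypothesis on the interior product; written out with
  \<open>\<Sum>\<^sub>J \<nu>\<^sub>J \<partial>\<^sub>K \<nu>\<^sub>J = 0\<close>, which is the derivative of \<open>|\<nu>|\<^sup>2 = 1\<close>, it gives the formula for
  \<open>\<delta>\<^sub>K D\<close> (\<open>normal_part\<close>), whence the claimed equivalence. For the restriction, the terms of
  \<open>d\<theta>\<^sup># = dD \<and> \<nu>\<^sup># + D d\<nu>\<^sup># - dF\<^sup>#\<close> are projected to \<open>\<nu>\<^sup>\<bottom>\<close>: the first one disappears, the coefficients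
  of the projection of \<open>d\<nu>\<^sup>#\<close> are \<open>\<delta>\<^sub>I \<nu>\<^sub>J - \<delta>\<^sub>J \<nu>\<^sub>I\<close>, and the projection of \<open>dF\<^sup>#\<close> is the expression in \<open>h\<close>
  on the right of the structure equation. So that equation says exactly that \<open>d\<theta>\<^sup>#\<close> has no
  tangential part (\<open>tangential_part\<close>).

  The potential \<open>u\<close> is obtained by integrating \<open>\<theta>\<close> along rays from a base point
  (\<open>symmetric_derivative_imp_potential\<close>). It is smooth because its partial derivatives are the components
  of \<open>\<theta>\<close>, which are smooth as the classes \<open>C\<^sup>k\<close> are closed under products and differences.
\<close>

section \<open>Calculus of partial derivatives\<close>

lemma partial_eq_derivative_axis: "(f has_derivative f') (at x) \<Longrightarrow> partial J f x = f' (axis J 1)"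
proof -
  assume f: "(f has_derivative f') (at x)"
  have "((\<lambda>t. f (x + t *\<^sub>R axis J 1)) has_derivative (\<lambda>t. f' (t *\<^sub>R axis J 1))) (at 0)"
    by (rule has_derivative_compose[where g=f]) (use f in \<open>auto intro!: derivative_eq_intros\<close>)
  moreover have "(\<lambda>t. f' (t *\<^sub>R axis J 1)) = (*) (f' (axis J 1))"
    using linear_cmul[OF has_derivative_linear[OF f]] by (auto simp: mult.commute)
  ultimately have "((\<lambda>t. f (x + t *\<^sub>R axis J 1)) has_field_derivative f' (axis J 1)) (at 0)"
    by (simp add: has_field_derivative_def)
  then show ?thesis unfolding partial_def by (rule DERIV_imp_deriv)
qed

lemma partial_cong:
  assumes "open U" "x \<in> U" "\<And>y. y \<in> U \<Longrightarrow> f y = g y"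
  shows "partial J f x = partial J g x"
proof -
  have "eventually (\<lambda>t. x + t *\<^sub>R axis J 1 \<in> U) (nhds (0::real))"
    using assms(1,2)
    by (intro topological_tendstoD[where l = x and F = "nhds 0"])
       (auto intro!: tendsto_eq_intros filterlim_ident)
  then show ?thesis unfolding partial_def
    by (intro deriv_cong_ev) (auto elim: eventually_mono simp: assms)
qed

lemma has_derivative_partials:
  assumes "f differentiable (at x)"
  shows "(f has_derivative (\<lambda>v. \<Sum>J\<in>UNIV. v $ J * partial J f x)) (at x)"
proof -
  obtain f' where f': "(f has_derivative f') (at x)" using assms by (auto simp: differentiable_def)
  have "f' v = (\<Sum>J\<in>UNIV. v $ J * partial J f x)" for v
  proof -
    have "f' v = f' (\<Sum>J\<in>UNIV. v $ J *\<^sub>R axis J 1)" using basis_expansion[of v] by (simp add: scalar_mult_eq_scaleR)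
    then show ?thesis
      using has_derivative_linear[OF f'] by (simp add: linear_sum linear_cmul partial_eq_derivative_axis[OF f'])
  qed
  then have "f' = (\<lambda>v. \<Sum>J\<in>UNIV. v $ J * partial J f x)" by blast
  with f' show ?thesis by simp
qed

lemma sum_axis: "(\<Sum>J\<in>UNIV. (axis K 1 :: real^'m) $ J * a J) = a (K :: 'm::finite)"
  by (simp add: axis_def if_distrib[of "\<lambda>c. c * _"] cong: if_cong)

lemma partial_diff:
  assumes "f differentiable (at x)" "g differentiable (at x)"
  shows "partial J (\<lambda>y. f y - g y) x = partial J f x - partial J g x"
  using partial_eq_derivative_axis[OF has_derivative_diff[OF assms[THEN has_derivative_partials]], of J]
  by (simp add: sum_axis)

lemma partial_mult:
  assumes "f differentiable (at x)" "g differentiable (at x)"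
  shows "partial J (\<lambda>y. f y * g y) x = f x * partial J g x + partial J f x * g x"
  using partial_eq_derivative_axis[OF has_derivative_mult[OF assms[THEN has_derivative_partials]], of J]
  by (simp add: sum_axis)

lemma partial_add:
  assumes "f differentiable (at x)" "g differentiable (at x)"
  shows "partial J (\<lambda>y. f y + g y) x = partial J f x + partial J g x"
  using partial_eq_derivative_axis[OF has_derivative_add[OF assms[THEN has_derivative_partials]], of J]
  by (simp add: sum_axis)

section \<open>Functions of class \<open>C\<^sup>k\<close>\<close>

text \<open>
  The sum, difference and product rules for partial derivatives need differentiability, so they
  are equations between functions only on \<open>U\<close>. Partial derivatives on an open set depend only on
  the values there, so such equations may nevertheless be substituted in inductions on \<open>k\<close>.
\<close>

lemma Ck_on_cong:
  assumes "open U" "\<And>x. x \<in> U \<Longrightarrow> f x = g x" "Ck_on k U f"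
  shows "Ck_on k U g"
  using assms(2,3)
proof (induction k arbitrary: f g)
  case 0
  then show ?case by (metis Ck_on.simps(1) continuous_on_cong)
next
  case (Suc k)
  have "g differentiable_on U"
    unfolding differentiable_on_def
  proof
    fix x assume "x \<in> U"
    then show "g differentiable (at x within U)"
      using Suc.prems by (auto simp: differentiable_on_def
          intro: differentiable_transform_within[where f = f and d = 1])
  qed
  moreover have "Ck_on k U (partial J g)" for J
  proof (rule Suc.IH)
    show "partial J f x = partial J g x" if "x \<in> U" for x
      using assms(1) that Suc.prems(1) by (rule partial_cong)
    show "Ck_on k U (partial J f)"
      using Suc.prems(2) by simp
  qed
  ultimately show ?case by simp
qed

lemma Ck_on_Suc: "Ck_on (Suc k) U f \<Longrightarrow> Ck_on k U f"
proof (induction k arbitrary: f)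
  case 0
  then show ?case by (simp add: differentiable_imp_continuous_on)
next
  case (Suc k)
  then show ?case using Ck_on.simps(2) by blast
qed

lemma Ck_on_subset: "Ck_on k U f \<Longrightarrow> V \<subseteq> U \<Longrightarrow> Ck_on k V f"
proof (induction k arbitrary: f)
  case 0
  then show ?case by (simp add: continuous_on_subset)
next
  case (Suc k)
  then show ?case using differentiable_on_subset by (metis Ck_on.simps(2))
qed

lemma Ck_on_add:
  assumes "open U" "Ck_on k U f" "Ck_on k U g"
  shows "Ck_on k U (\<lambda>x. f x + g x)"
  using assms(2,3)
proof (induction k arbitrary: f g)
  case (Suc k)
  have "Ck_on k U (partial J (\<lambda>x. f x + g x))" for J
    by (rule Ck_on_cong[OF assms(1) _ Suc.IH[of "partial J f" "partial J g"]])
       (use Suc.prems in \<open>simp_all add: partial_add differentiable_on_eq_differentiable_at[OF assms(1)]\<close>)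
  then show ?case using Suc.prems by (simp add: differentiable_on_add)
qed (simp add: continuous_on_add)

lemma Ck_on_diff:
  assumes "open U" "Ck_on k U f" "Ck_on k U g"
  shows "Ck_on k U (\<lambda>x. f x - g x)"
  using assms(2,3)
proof (induction k arbitrary: f g)
  case (Suc k)
  have "Ck_on k U (partial J (\<lambda>x. f x - g x))" for J
    by (rule Ck_on_cong[OF assms(1) _ Suc.IH[of "partial J f" "partial J g"]])
       (use Suc.prems in \<open>simp_all add: partial_diff differentiable_on_eq_differentiable_at[OF assms(1)]\<close>)
  then show ?case using Suc.prems by (simp add: differentiable_on_diff)
qed (simp add: continuous_on_diff)

text \<open>
  The product rule for \<open>\<partial>\<^sub>J (f g)\<close> contains \<open>f\<close> and \<open>g\<close> themselves, whose \<open>C\<^sup>k\<close> regularity in the step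
  to \<open>k + 1\<close> comes from \<open>Ck_on_Suc\<close>.
\<close>

lemma Ck_on_mult:
  assumes "open U" "Ck_on k U f" "Ck_on k U g"
  shows "Ck_on k U (\<lambda>x. f x * g x)"
  using assms(2,3)
proof (induction k arbitrary: f g)
  case (Suc k)
  have "Ck_on k U (\<lambda>x. f x * partial J g x + partial J f x * g x)" for J
    using Suc.prems Suc.prems[THEN Ck_on_Suc] by (intro Ck_on_add[OF assms(1)] Suc.IH) auto
  then have "Ck_on k U (partial J (\<lambda>x. f x * g x))" for J
    by (rule Ck_on_cong[OF assms(1), rotated])
       (use Suc.prems in \<open>simp_all add: partial_mult differentiable_on_eq_differentiable_at[OF assms(1)]\<close>)
  then show ?case using Suc.prems by (simp add: differentiable_on_mult)
qed (simp add: continuous_on_mult)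

lemma smooth_on_imp_differentiable:
  "smooth_on U f \<Longrightarrow> open U \<Longrightarrow> x \<in> U \<Longrightarrow> f differentiable (at x)"
  by (metis Ck_on.simps(2) differentiable_on_eq_differentiable_at smooth_on_def)

lemma smooth_on_imp_continuous_partial: "smooth_on U f \<Longrightarrow> continuous_on U (partial J f)"
  by (metis Ck_on.simps smooth_on_def)

section \<open>The Poincare lemma\<close>

text \<open>
  The derivative \<open>T\<close> of a vector field being symmetric means that the corresponding 1-form is closed.
  The potential is \<open>u x = \<integral>\<^sub>0\<^sup>1 \<theta> (p + t (x - p)) \<bullet> (x - p) dt\<close>. Differentiated under the integral sign
  in direction \<open>v\<close>, the integrand becomes, after moving \<open>v\<close> to the other side by symmetry of \<open>T\<close>, the
  inner product of \<open>v\<close> with the \<open>t\<close>-derivative of \<open>t \<theta> (p + t (x - p))\<close>; the fundamental theorem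
  of calculus evaluates this to \<open>\<theta> x \<bullet> v\<close>.
\<close>

lemma symmetric_derivative_imp_potential:
  fixes \<theta> :: "'a::euclidean_space \<Rightarrow> 'a" and T :: "'a \<Rightarrow> 'a \<Rightarrow>\<^sub>L 'a"
  assumes "open V" "convex V"
    and der: "\<And>x. x \<in> V \<Longrightarrow> (\<theta> has_derivative blinfun_apply (T x)) (at x)"
    and cont: "continuous_on V T"
    and sym: "\<And>x v w. x \<in> V \<Longrightarrow> T x v \<bullet> w = T x w \<bullet> v"
  shows "\<exists>u. \<forall>x\<in>V. (u has_derivative (\<lambda>v. \<theta> x \<bullet> v)) (at x)"
proof (cases "V = {}")
  case False
  then obtain p where p: "p \<in> V" by blast
  define \<gamma> where "\<gamma> x t = p + t *\<^sub>R (x - p)" for x and t :: real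
  define G where "G x t = t *\<^sub>R T (\<gamma> x t) (x - p) + \<theta> (\<gamma> x t)" for x t
  define u where "u x = integral (cbox 0 1) (\<lambda>t. \<theta> (\<gamma> x t) \<bullet> (x - p))" for x
  have \<gamma>V: "\<gamma> x t \<in> V" if "x \<in> V" "t \<in> cbox 0 1" for x t
    using that \<open>convex V\<close> p convexD_alt[of V p x t] unfolding \<gamma>_def by (auto simp: algebra_simps)
  have cont\<theta>: "continuous_on V \<theta>"
    using der has_derivative_continuous by (blast intro: continuous_at_imp_continuous_on)
  have cont\<gamma>: "continuous_on S (\<lambda>z. \<gamma> (fst z) (snd z))" for S
    unfolding \<gamma>_def by (intro continuous_intros)
  have contG: "continuous_on (V \<times> cbox 0 1) (\<lambda>z. G (fst z) (snd z))"
    unfolding G_def using \<gamma>V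
    by (intro continuous_intros continuous_on_compose2[OF cont cont\<gamma>]
        continuous_on_compose2[OF cont\<theta> cont\<gamma>]) auto
  have "(u has_derivative (\<lambda>v. \<theta> x \<bullet> v)) (at x)" if x: "x \<in> V" for x
  proof -
    have integrand: "((\<lambda>x. \<theta> (\<gamma> x t) \<bullet> (x - p)) has_derivative blinfun_inner_right (G x t)) (at x within V)"
      if "x \<in> V" "t \<in> cbox 0 1" for x t
    proof -
      have "((\<lambda>x. \<gamma> x t) has_derivative (\<lambda>v. t *\<^sub>R v)) (at x within V)"
        unfolding \<gamma>_def by (auto intro!: derivative_eq_intros)
      then have "((\<lambda>x. \<theta> (\<gamma> x t)) has_derivative (\<lambda>v. T (\<gamma> x t) (t *\<^sub>R v))) (at x within V)"
        by (rule has_derivative_compose) (rule der[OF \<gamma>V[OF that]])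
      then have "((\<lambda>x. \<theta> (\<gamma> x t) \<bullet> (x - p)) has_derivative
         (\<lambda>v. \<theta> (\<gamma> x t) \<bullet> v + T (\<gamma> x t) (t *\<^sub>R v) \<bullet> (x - p))) (at x within V)"
        by (auto intro!: derivative_eq_intros)
      moreover have "(\<lambda>v. \<theta> (\<gamma> x t) \<bullet> v + T (\<gamma> x t) (t *\<^sub>R v) \<bullet> (x - p)) = blinfun_inner_right (G x t)"
        using sym[OF \<gamma>V[OF that]]
        by (auto simp: G_def blinfun.scaleR_right inner_add_left fun_eq_iff)
      ultimately show ?thesis by simp
    qed
    have "(u has_derivative integral (cbox 0 1) (\<lambda>t. blinfun_inner_right (G x t))) (at x within V)"
      unfolding u_def
    proof (rule leibniz_rule[OF integrand])
      show "(\<lambda>t. \<theta> (\<gamma> x t) \<bullet> (x - p)) integrable_on cbox 0 1" if "x \<in> V" for x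
        using \<gamma>V[OF that] by (intro integrable_continuous continuous_intros continuous_on_compose2[OF cont\<theta>])
          (auto simp: \<gamma>_def intro!: continuous_intros)
      show "continuous_on (V \<times> cbox 0 1) (\<lambda>(x, t). blinfun_inner_right (G x t))"
        using bounded_linear.continuous_on[OF bounded_linear_blinfun_inner_right contG]
        by (simp add: case_prod_unfold)
    qed (use x \<open>convex V\<close> in auto)
    moreover have "((\<lambda>t. blinfun_inner_right (G x t)) has_integral blinfun_inner_right (\<theta> x)) (cbox 0 1)"
    proof -
      \<comment> \<open>No boundary term survives at the base point, because of the factor \<open>t\<close>.\<close>
      have "((\<lambda>t. t *\<^sub>R \<theta> (\<gamma> x t)) has_vector_derivative G x t) (at t within {0..1})"
        if "t \<in> {0..1}" for t
      proof -
        have "((\<lambda>t. \<gamma> x t) has_derivative (\<lambda>s. s *\<^sub>R (x - p))) (at t within {0..1})"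
          unfolding \<gamma>_def by (auto intro!: derivative_eq_intros)
        then have "((\<lambda>t. \<theta> (\<gamma> x t)) has_derivative (\<lambda>s. T (\<gamma> x t) (s *\<^sub>R (x - p)))) (at t within {0..1})"
          by (rule has_derivative_compose) (use \<gamma>V x that in \<open>auto intro!: der\<close>)
        then show ?thesis
          unfolding has_vector_derivative_def G_def
          by (auto intro!: derivative_eq_intros simp: blinfun.scaleR_right fun_eq_iff mult.commute scaleR_add_right)
      qed
      from fundamental_theorem_of_calculus[OF _ this]
      have "(G x has_integral \<theta> x) {0..1}" by (simp add: \<gamma>_def)
      from has_integral_linear[OF this bounded_linear_blinfun_inner_right]
      show ?thesis by (simp add: o_def)
    qed
    ultimately show ?thesis
      using x at_within_open[OF _ \<open>open V\<close>]
      by (simp add: integral_unique)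
  qed
  then show ?thesis by blast
qed simp

text \<open>
  The Poincare lemma in the smooth category. Smoothness of \<open>\<theta>\<close> makes its Jacobian continuous, and the
  potential inherits smoothness, since its gradient is \<open>\<theta>\<close>.
\<close>

lemma closed_form_smooth_potential:
  fixes \<theta> :: "real^'m::finite \<Rightarrow> real^'m"
  assumes V: "open V" "convex V" and sm: "smooth_field_on V \<theta>"
    and closed: "\<And>x J K. x \<in> V \<Longrightarrow> partial J (\<lambda>y. \<theta> y $ K) x = partial K (\<lambda>y. \<theta> y $ J) x"
  obtains u where "smooth_on V u" "\<And>x. x \<in> V \<Longrightarrow> grad u x = \<theta> x"
proof -
  have sm': "smooth_on V (\<lambda>y. \<theta> y $ J)" for J
    using sm by (simp add: smooth_field_on_def)
  define T' where "T' x v = (\<chi> K. \<Sum>J\<in>UNIV. v $ J * partial J (\<lambda>y. \<theta> y $ K) x)" for x v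
  define T where "T x = Blinfun (T' x)" for x
  have "bounded_linear (T' x)" for x
    unfolding linear_conv_bounded_linear[symmetric] T'_def
    by (rule linearI) (auto simp: vec_eq_iff algebra_simps sum.distrib sum_distrib_left)
  then have T: "blinfun_apply (T x) = T' x" for x
    by (simp add: T_def bounded_linear_Blinfun_apply)
  have "\<exists>u. \<forall>x\<in>V. (u has_derivative (\<lambda>v. \<theta> x \<bullet> v)) (at x)"
  proof (rule symmetric_derivative_imp_potential[OF V])
    show "(\<theta> has_derivative blinfun_apply (T x)) (at x)" if "x \<in> V" for x
      unfolding T T'_def
      by (subst has_derivative_componentwise_within)
         (use has_derivative_partials[OF smooth_on_imp_differentiable[OF sm' V(1) that]]
          in \<open>auto simp: Basis_vec_def inner_axis\<close>)
    show "continuous_on V T"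
    proof (rule continuous_on_blinfun_componentwise)
      show "continuous_on V (\<lambda>x. T x i)" for i
        unfolding T T'_def
        by (intro continuous_intros smooth_on_imp_continuous_partial sm')
    qed
    show "T x v \<bullet> w = T x w \<bullet> v" if "x \<in> V" for x v w
    proof -
      have "T x v \<bullet> w = (\<Sum>K\<in>UNIV. \<Sum>J\<in>UNIV. v $ J * partial J (\<lambda>y. \<theta> y $ K) x * w $ K)"
        by (simp add: T T'_def inner_vec_def sum_distrib_right)
      also have "\<dots> = (\<Sum>J\<in>UNIV. \<Sum>K\<in>UNIV. v $ J * partial J (\<lambda>y. \<theta> y $ K) x * w $ K)"
        by (rule sum.swap)
      also have "\<dots> = (\<Sum>J\<in>UNIV. \<Sum>K\<in>UNIV. w $ K * partial K (\<lambda>y. \<theta> y $ J) x * v $ J)"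
        by (intro sum.cong refl) (subst closed[OF that], simp)
      also have "\<dots> = T x w \<bullet> v"
        by (simp add: T T'_def inner_vec_def sum_distrib_right)
      finally show ?thesis .
    qed
  qed
  then obtain u where u: "\<And>x. x \<in> V \<Longrightarrow> (u has_derivative (\<lambda>v. \<theta> x \<bullet> v)) (at x)" by blast
  have pu: "partial J u x = \<theta> x $ J" if "x \<in> V" for J x
    using partial_eq_derivative_axis[OF u[OF that]] by (simp add: inner_axis)
  have ud: "u differentiable_on V"
    using u V(1) by (auto simp: differentiable_on_eq_differentiable_at differentiable_def)
  have "Ck_on k V u" for k
  proof (cases k)
    case 0
    then show ?thesis using ud by (simp add: differentiable_imp_continuous_on)
  next
    case (Suc n)
    have "Ck_on n V (partial J u)" for J
      by (rule Ck_on_cong[OF V(1), of "\<lambda>y. \<theta> y $ J"]) (use sm'[of J] in \<open>simp_all add: pu smooth_on_def\<close>)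
    then show ?thesis using Suc ud by simp
  qed
  then show ?thesis using that[of u] pu by (simp add: smooth_on_def grad_def vec_eq_iff)
qed

section \<open>Normal and tangential parts of the exterior derivative\<close>

lemma flat_axis: "flat G y (axis K 1) = G y $ K"
  by (simp add: flat_def dx_def axis_def if_distrib[of "\<lambda>c. _ * c"] cong: if_cong)

text \<open>
  The coefficient matrix of \<open>dG\<^sup>#\<close> is \<open>h G\<close>: exchanging the summation indices in the second half of the
  double sum defining \<open>ext_d\<close> collects the two terms of \<open>h G J K\<close>.
\<close>

lemma interior_prod_ext_d_flat:
  "interior_prod (flat \<nu> x) (ext_d (flat G) x) w = (\<Sum>K\<in>UNIV. w $ K * (\<Sum>J\<in>UNIV. \<nu> x $ J * h G J K x))"
proof -
  let ?P = "\<lambda>J K. partial J (\<lambda>y. G y $ K) x"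
  have "interior_prod (flat \<nu> x) (ext_d (flat G) x) w
      = (\<Sum>K\<in>UNIV. \<Sum>J\<in>UNIV. ?P J K * \<nu> x $ J * w $ K) - (\<Sum>K\<in>UNIV. \<Sum>J\<in>UNIV. ?P J K * w $ J * \<nu> x $ K)"
    by (simp add: interior_prod_def ext_d_def flat_axis vec_of_def wedge_def dx_def
        sum_subtractf algebra_simps)
  also have "(\<Sum>K\<in>UNIV. \<Sum>J\<in>UNIV. ?P J K * w $ J * \<nu> x $ K) = (\<Sum>K\<in>UNIV. \<Sum>J\<in>UNIV. ?P K J * w $ K * \<nu> x $ J)"
    by (rule sum.swap)
  finally show ?thesis
    by (simp add: h_def sum_subtractf sum_distrib_left algebra_simps)
qed

lemma interior_prod_ext_d_flat_eq_0_iff: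
  "interior_prod (flat \<nu> x) (ext_d (flat G) x) = (\<lambda>_. 0) \<longleftrightarrow>
    (\<forall>K. (\<Sum>J\<in>UNIV. \<nu> x $ J * h G J K x) = 0)"
proof
  assume L: "interior_prod (flat \<nu> x) (ext_d (flat G) x) = (\<lambda>_. 0)"
  show "\<forall>K. (\<Sum>J\<in>UNIV. \<nu> x $ J * h G J K x) = 0"
  proof
    fix K
    show "(\<Sum>J\<in>UNIV. \<nu> x $ J * h G J K x) = 0"
      using fun_cong[OF L, of "axis K 1"] unfolding interior_prod_ext_d_flat
      by (simp add: sum_axis)
  qed
qed (simp add: interior_prod_ext_d_flat fun_eq_iff)

text \<open>Half the derivative of \<open>\<Sum>\<^sub>J \<nu>\<^sub>J \<nu>\<^sub>J = 1\<close>.\<close>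

lemma unit_field_partial_orthogonal:
  assumes "open U" "x \<in> U" "\<forall>y\<in>U. norm (\<nu> y) = 1"
    and d: "\<And>J. (\<lambda>y. \<nu> y $ J) differentiable (at x)"
  shows "(\<Sum>J\<in>UNIV. \<nu> x $ J * partial K (\<lambda>y. \<nu> y $ J) x) = 0"
proof -
  have "((\<lambda>y. \<Sum>J\<in>UNIV. \<nu> y $ J * \<nu> y $ J) has_derivative
        (\<lambda>v. \<Sum>J\<in>UNIV. \<nu> x $ J * (\<Sum>L\<in>UNIV. v $ L * partial L (\<lambda>y. \<nu> y $ J) x)
          + (\<Sum>L\<in>UNIV. v $ L * partial L (\<lambda>y. \<nu> y $ J) x) * \<nu> x $ J)) (at x)"
    by (intro has_derivative_sum has_derivative_mult has_derivative_partials d)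
  from partial_eq_derivative_axis[OF this, of K]
  have "partial K (\<lambda>y. \<Sum>J\<in>UNIV. \<nu> y $ J * \<nu> y $ J) x = 2 * (\<Sum>J\<in>UNIV. \<nu> x $ J * partial K (\<lambda>y. \<nu> y $ J) x)"
    by (simp add: sum_axis sum.distrib sum_distrib_left mult.commute)
  moreover have "partial K (\<lambda>y. \<Sum>J\<in>UNIV. \<nu> y $ J * \<nu> y $ J) x = partial K (\<lambda>y. 1) x"
    by (rule partial_cong[OF assms(1,2)]) (use assms(3) in \<open>auto simp: norm_eq_1 inner_vec_def\<close>)
  ultimately show ?thesis by (simp add: partial_def)
qed

context
  fixes U :: "(real^'m::finite) set" and D :: "real^'m \<Rightarrow> real" and \<nu> F :: "real^'m \<Rightarrow> real^'m"
    and x :: "real^'m"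
  assumes U: "open U" "x \<in> U" and unit: "\<forall>y\<in>U. norm (\<nu> y) = 1"
    and dD: "D differentiable (at x)"
    and d\<nu>: "\<And>J. (\<lambda>y. \<nu> y $ J) differentiable (at x)"
    and dF: "\<And>J. (\<lambda>y. F y $ J) differentiable (at x)"
begin

text \<open>The Leibniz rule \<open>d(D\<nu>\<^sup># - F\<^sup>#) = dD \<and> \<nu>\<^sup># + D d\<nu>\<^sup># - dF\<^sup>#\<close> in coordinates.\<close>

lemma h_scaled_minus:
  "h (\<lambda>y. D y *\<^sub>R \<nu> y - F y) I J x
    = partial I D x * \<nu> x $ J - partial J D x * \<nu> x $ I + D x * h \<nu> I J x - h F I J x"
proof -
  have "partial I (\<lambda>y. D y * \<nu> y $ J - F y $ J) x
     = D x * partial I (\<lambda>y. \<nu> y $ J) x + partial I D x * \<nu> x $ J - partial I (\<lambda>y. F y $ J) x" for I J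
    using dD d\<nu> dF by (simp add: partial_diff partial_mult differentiable_mult)
  from this[of I J] this[of J I] show ?thesis by (simp add: h_def right_diff_distrib)
qed

text \<open>The half of the contraction that differentiates \<open>|\<nu>|\<^sup>2\<close> drops out.\<close>

lemma normal_h: "(\<Sum>K\<in>UNIV. \<nu> x $ K * h \<nu> K J x) = (\<Sum>K\<in>UNIV. \<nu> x $ K * partial K (\<lambda>y. \<nu> y $ J) x)"
  using unit_field_partial_orthogonal[OF U unit d\<nu>, of J]
  by (simp add: h_def right_diff_distrib sum_subtractf)

text \<open>
  Contracting the Leibniz rule with \<open>\<nu>\<close>: the two terms of \<open>dD \<and> \<nu>\<^sup>#\<close> combine to \<open>- \<delta>\<^sub>K D\<close>, as \<open>|\<nu>| = 1\<close>.
  Hence the vanishing of the contraction is the formula for \<open>\<delta>\<^sub>K D\<close>.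
\<close>

lemma normal_part:
  "(\<Sum>J\<in>UNIV. \<nu> x $ J * h (\<lambda>y. D y *\<^sub>R \<nu> y - F y) J K x)
    = (\<Sum>J\<in>UNIV. \<nu> x $ J * partial J (\<lambda>y. \<nu> y $ K) x * D x)
      - (\<Sum>J\<in>UNIV. \<nu> x $ J * h F J K x) - delta \<nu> K D x"
proof -
  have "(\<Sum>J\<in>UNIV. \<nu> x $ J * h (\<lambda>y. D y *\<^sub>R \<nu> y - F y) J K x)
    = \<nu> x $ K * (\<Sum>J\<in>UNIV. \<nu> x $ J * partial J D x) - partial K D x * (\<Sum>J\<in>UNIV. \<nu> x $ J * \<nu> x $ J)
      + D x * (\<Sum>J\<in>UNIV. \<nu> x $ J * h \<nu> J K x) - (\<Sum>J\<in>UNIV. \<nu> x $ J * h F J K x)"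
    by (simp add: h_scaled_minus sum_distrib_left sum_subtractf sum.distrib algebra_simps)
  moreover have "(\<Sum>J\<in>UNIV. \<nu> x $ J * \<nu> x $ J) = 1"
    using unit U(2) by (auto simp: norm_eq_1 inner_vec_def)
  ultimately show ?thesis
    by (simp add: normal_h delta_def sum_distrib_left sum_distrib_right mult_ac)
qed

text \<open>
  For a 2-form \<open>\<omega>\<close>, the matrix \<open>\<omega>\<^sub>I\<^sub>J - \<nu>\<^sub>I \<nu>\<^sub>K \<omega>\<^sub>K\<^sub>J + \<nu>\<^sub>J \<nu>\<^sub>K \<omega>\<^sub>K\<^sub>I\<close> is the projection of \<open>\<omega>\<close> to the orthogonal
  complement of \<open>\<nu>\<close>. The identity says that this projection of \<open>d(D\<nu>\<^sup># - F\<^sup>#)\<close> is the difference of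
  the two sides of the structure equation for \<open>\<delta>\<^sub>I \<nu>\<^sub>J - \<delta>\<^sub>J \<nu>\<^sub>I\<close>, cleared of the denominator \<open>D\<close>.
\<close>

lemma tangential_part:
  "D x * (delta \<nu> I (\<lambda>y. \<nu> y $ J) x - delta \<nu> J (\<lambda>y. \<nu> y $ I) x)
     - (h F I J x - (\<Sum>K\<in>UNIV. \<nu> x $ J * \<nu> x $ K * h F I K x)
            - (\<Sum>K\<in>UNIV. \<nu> x $ I * \<nu> x $ K * h F K J x))
   = h (\<lambda>y. D y *\<^sub>R \<nu> y - F y) I J x
     - \<nu> x $ I * (\<Sum>K\<in>UNIV. \<nu> x $ K * h (\<lambda>y. D y *\<^sub>R \<nu> y - F y) K J x)
     + \<nu> x $ J * (\<Sum>K\<in>UNIV. \<nu> x $ K * h (\<lambda>y. D y *\<^sub>R \<nu> y - F y) K I x)"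
proof -
  \<comment> \<open>The terms with \<open>?s\<close>, the derivative of \<open>D\<close> along \<open>\<nu>\<close>, cancel, since they carry \<open>\<nu>\<^sub>I \<nu>\<^sub>J\<close>
    with opposite signs.\<close>
  let ?N = "\<lambda>J. \<Sum>K\<in>UNIV. \<nu> x $ K * partial K (\<lambda>y. \<nu> y $ J) x"
  let ?H = "\<lambda>J. \<Sum>K\<in>UNIV. \<nu> x $ K * h F K J x"
  let ?s = "\<Sum>K\<in>UNIV. \<nu> x $ K * partial K D x"
  have a: "(\<Sum>K\<in>UNIV. \<nu> x $ J * \<nu> x $ K * h F I K x) = - \<nu> x $ J * ?H I"
    by (simp add: sum_distrib_left h_def algebra_simps flip: sum_negf)
  have b: "(\<Sum>K\<in>UNIV. \<nu> x $ I * \<nu> x $ K * h F K J x) = \<nu> x $ I * ?H J"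
    by (simp add: sum_distrib_left mult.assoc)
  have c: "(\<Sum>K\<in>UNIV. \<nu> x $ K * h (\<lambda>y. D y *\<^sub>R \<nu> y - F y) K J x)
     = D x * ?N J - ?H J - partial J D x + \<nu> x $ J * ?s" for J
    unfolding normal_part delta_def by (simp add: sum_distrib_left mult_ac)
  show ?thesis
    unfolding a b c unfolding h_scaled_minus delta_def h_def[of \<nu>] by (simp add: algebra_simps)
qed

end

section \<open>Existence of a local potential\<close>

theorem theoremE:
  fixes U :: "(real^'m::finite) set"
    and D :: "real^'m \<Rightarrow> real"
    and \<nu> F :: "real^'m \<Rightarrow> real^'m"
  assumes "CARD('m) \<ge> 2"
    and "open U"
    and "smooth_on U D" and "\<forall>x\<in>U. D x > 0"
    and "smooth_field_on U \<nu>" and "\<forall>x\<in>U. norm (\<nu> x) = 1"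
    and "smooth_field_on U F"
  shows
    "((\<forall>x\<in>U. interior_prod (flat \<nu> x)
          (ext_d (\<lambda>y v. D y * flat \<nu> y v - flat F y v) x) = (\<lambda>_. 0))
      \<longleftrightarrow>
      (\<forall>x\<in>U. \<forall>K. delta \<nu> K D x =
          (\<Sum>J\<in>UNIV. \<nu> x $ J * partial J (\<lambda>y. \<nu> y $ K) x * D x)
          - (\<Sum>J\<in>UNIV. \<nu> x $ J * h F J K x)))
     \<and>
     ((\<forall>x\<in>U. \<forall>I J.
          delta \<nu> I (\<lambda>y. \<nu> y $ J) x - delta \<nu> J (\<lambda>y. \<nu> y $ I) x =
          1 / D x * (h F I J x
            - (\<Sum>K\<in>UNIV. \<nu> x $ J * \<nu> x $ K * h F I K x)
            - (\<Sum>K\<in>UNIV. \<nu> x $ I * \<nu> x $ K * h F K J x)))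
      \<longrightarrow>
      (\<forall>x\<in>U. interior_prod (flat \<nu> x)
          (ext_d (\<lambda>y v. D y * flat \<nu> y v - flat F y v) x) = (\<lambda>_. 0))
      \<longrightarrow>
      (\<forall>p\<in>U. \<exists>V u. open V \<and> p \<in> V \<and> V \<subseteq> U \<and> smooth_on V u \<and>
          (\<forall>x\<in>V. \<nu> x = (grad u x + F x) /\<^sub>R D x)))"
proof -
  define \<theta> where "\<theta> y = D y *\<^sub>R \<nu> y - F y" for y
  have flat\<theta>: "(\<lambda>y v. D y * flat \<nu> y v - flat F y v) = flat \<theta>"
    by (simp add: fun_eq_iff \<theta>_def flat_def sum_distrib_left sum_subtractf algebra_simps)
  have sm\<nu>: "smooth_on U (\<lambda>y. \<nu> y $ J)" and smF: "smooth_on U (\<lambda>y. F y $ J)" for J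
    using assms(5,7) by (simp_all add: smooth_field_on_def)
  have sm\<theta>: "smooth_field_on U \<theta>"
    using assms(3) sm\<nu> smF
    by (simp add: smooth_field_on_def smooth_on_def \<theta>_def Ck_on_diff Ck_on_mult \<open>open U\<close>)
  note diff = smooth_on_imp_differentiable[OF _ \<open>open U\<close>]
  note at_point = \<open>open U\<close> _ \<open>\<forall>x\<in>U. norm (\<nu> x) = 1\<close> diff[OF \<open>smooth_on U D\<close>] diff[OF sm\<nu>] diff[OF smF]
  note normal = normal_part[OF at_point, folded \<theta>_def]
  note tangential = tangential_part[OF at_point, folded \<theta>_def]
  have equiv: "(interior_prod (flat \<nu> x) (ext_d (flat \<theta>) x) = (\<lambda>_. 0)) \<longleftrightarrow>
      (\<forall>K. delta \<nu> K D x = (\<Sum>J\<in>UNIV. \<nu> x $ J * partial J (\<lambda>y. \<nu> y $ K) x * D x)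
          - (\<Sum>J\<in>UNIV. \<nu> x $ J * h F J K x))" if "x \<in> U" for x
    unfolding interior_prod_ext_d_flat_eq_0_iff using normal[OF that] that by force
  have potential: "\<exists>V u. open V \<and> p \<in> V \<and> V \<subseteq> U \<and> smooth_on V u \<and>
          (\<forall>x\<in>V. \<nu> x = (grad u x + F x) /\<^sub>R D x)"
    if tan: "\<forall>x\<in>U. \<forall>I J.
          delta \<nu> I (\<lambda>y. \<nu> y $ J) x - delta \<nu> J (\<lambda>y. \<nu> y $ I) x =
          1 / D x * (h F I J x
            - (\<Sum>K\<in>UNIV. \<nu> x $ J * \<nu> x $ K * h F I K x)
            - (\<Sum>K\<in>UNIV. \<nu> x $ I * \<nu> x $ K * h F K J x))"
      and nor: "\<forall>x\<in>U. interior_prod (flat \<nu> x) (ext_d (flat \<theta>) x) = (\<lambda>_. 0)"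
      and p: "p \<in> U" for p
  proof -
    \<comment> \<open>The projection of \<open>d\<theta>\<^sup>#\<close> vanishes, and it differs from \<open>d\<theta>\<^sup>#\<close> only by contractions with \<open>\<nu>\<close>.\<close>
    have closed: "h \<theta> I J x = 0" if x: "x \<in> U" for x I J
    proof -
      have "D x \<noteq> 0" using assms(4) x by force
      have "D x * (delta \<nu> I (\<lambda>y. \<nu> y $ J) x - delta \<nu> J (\<lambda>y. \<nu> y $ I) x)
          - (h F I J x - (\<Sum>K\<in>UNIV. \<nu> x $ J * \<nu> x $ K * h F I K x)
              - (\<Sum>K\<in>UNIV. \<nu> x $ I * \<nu> x $ K * h F K J x)) = 0"
        unfolding tan[rule_format, OF x, of I J] using \<open>D x \<noteq> 0\<close> by simp
      then show ?thesis
        using tangential[OF x x x x, of I J] nor x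
        by (simp add: interior_prod_ext_d_flat_eq_0_iff)
    qed
    obtain e where "e > 0" and e: "ball p e \<subseteq> U"
      using \<open>open U\<close> p open_contains_ball by metis
    obtain u where u: "smooth_on (ball p e) u" "\<And>x. x \<in> ball p e \<Longrightarrow> grad u x = \<theta> x"
    proof (rule closed_form_smooth_potential)
      show "smooth_field_on (ball p e) \<theta>"
        using sm\<theta> e by (auto simp: smooth_field_on_def smooth_on_def intro: Ck_on_subset)
      show "partial J (\<lambda>y. \<theta> y $ K) x = partial K (\<lambda>y. \<theta> y $ J) x" if "x \<in> ball p e" for x J K
        using closed[of x J K] e that by (auto simp: h_def)
    qed auto
    have "\<nu> x = (grad u x + F x) /\<^sub>R D x" if "x \<in> ball p e" for x
    proof -
      have "D x > 0" using assms(4) e that by blast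
      then show ?thesis using u(2)[OF that] by (simp add: \<theta>_def)
    qed
    then show ?thesis using u(1) e \<open>e > 0\<close> by (intro exI[of _ "ball p e"] exI[of _ u]) auto
  qed
  show ?thesis
    unfolding flat\<theta>
    by (intro conjI impI ballI ball_cong[OF refl equiv]) (assumption | rule potential)+
qed
end
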